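(* Suppose $G$ is a group of order $n$. If there is an $(s,t)$-$\lambda$-fold near-factorization of $G$, then $$\lambda\le\left\lfloor\frac{s+t+1}{4}\right\rfloor.$$
   Context: For subsets $S,T$ of a finite group $G$ with identity $e$, and a positive integer $\lambda$, $(S,T)$ is a $\lambda$-fold near-factorization of $G$ if every non-identity element $g\in G$ can be written as $g=xy$ with $x\in S$, $y\in T$ in exactly $\lambda$ ways, and $xy\neq e$ for all $x\in S$, $y\in T$. It is an $(s,t)$-$\lambda$-fold near-factorization if moreover $|S|=s$ and $|T|=t$.
   Formalization: The formal statement assumes n ≥ 3; for n ≤ 2 the claim fails for every near-factorization, since s+t ≤ n gives a bound of 0 < λ (e.g. G={e,g}, S={e}, T={g}, λ=1). *)

theory Defs
  imports Complex_Main "HOL-Algebra.Coset"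
begin

text \<open>
  Both definitions are meant for finite \<open>G\<close> only, since \<open>card\<close> of an infinite set is \<open>0\<close>.
\<close>

definition near_factorization ::
    "('a, 'b) monoid_scheme \<Rightarrow> nat \<Rightarrow> 'a set \<Rightarrow> 'a set \<Rightarrow> bool" where
  "near_factorization G l S T \<longleftrightarrow>
     0 < l \<and> S \<subseteq> carrier G \<and> T \<subseteq> carrier G \<and>
     (\<forall>g \<in> carrier G - {\<one>\<^bsub>G\<^esub>}. card {(x, y). x \<in> S \<and> y \<in> T \<and> g = x \<otimes>\<^bsub>G\<^esub> y} = l) \<and>
     (\<forall>x \<in> S. \<forall>y \<in> T. x \<otimes>\<^bsub>G\<^esub> y \<noteq> \<one>\<^bsub>G\<^esub>)"

definition st_near_factorization ::
    "('a, 'b) monoid_scheme \<Rightarrow> nat \<Rightarrow> nat \<Rightarrow> nat \<Rightarrow> 'a set \<Rightarrow> 'a set \<Rightarrow> bool" where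
  "st_near_factorization G s t l S T \<longleftrightarrow>
     near_factorization G l S T \<and> card S = s \<and> card T = t"

end

theory Submission
  imports Defs
begin

text \<open>
  Since \<open>S\<close> and the set of inverses of \<open>T\<close> are disjoint, \<open>s + t \<le> n\<close>, and counting
  products gives \<open>s t = \<lambda> (n - 1)\<close>. Hence
  \<open>4 \<lambda> (n - 1) = 4 s t \<le> (s + t)\<^sup>2\<close>, so that
  \<open>4 \<lambda> \<le> (s + t) n / (n - 1) \<le> s + t + 1 + 1 / (n - 1)\<close>, and \<open>4 \<lambda>\<close> is an integer.
\<close>

lemma near_factorization_card_mult:
  fixes G (structure)
  assumes "group G" "finite (carrier G)" "near_factorization G l S T"
  shows "card S * card T = l * (order G - 1)"
proof -
  interpret group G by fact
  let ?C = "carrier G - {\<one>}"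
  have S: "S \<subseteq> carrier G" and T: "T \<subseteq> carrier G"
    and fibres: "\<And>g. g \<in> ?C \<Longrightarrow> card {(x, y). x \<in> S \<and> y \<in> T \<and> g = x \<otimes> y} = l"
    and ne: "\<And>x y. x \<in> S \<Longrightarrow> y \<in> T \<Longrightarrow> x \<otimes> y \<noteq> \<one>"
    using assms(3) unfolding near_factorization_def by blast+
  have fin: "finite S" "finite T"
    using S T assms(2) finite_subset by blast+
  \<comment> \<open>Pairs are sorted by their product; since no product is \<open>\<one>\<close>,
    the fibres over \<open>?C\<close> already exhaust \<open>S \<times> T\<close>.\<close>
  have partition: "S \<times> T = (\<Union>g\<in>?C. {(x, y). x \<in> S \<and> y \<in> T \<and> g = x \<otimes> y})"
    using S T ne by (auto intro!: m_closed)
  have "finite {(x, y). x \<in> S \<and> y \<in> T \<and> g = x \<otimes> y}" for g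
    by (rule finite_subset[of _ "S \<times> T"]) (use fin in auto)
  then have "card (S \<times> T) = (\<Sum>g\<in>?C. card {(x, y). x \<in> S \<and> y \<in> T \<and> g = x \<otimes> y})"
    unfolding partition by (intro card_UN_disjoint) (use assms(2) in auto)
  then show ?thesis
    using fibres by (simp add: order_def card_cartesian_product)
qed

lemma near_factorization_card_add_le:
  fixes G (structure)
  assumes "group G" "finite (carrier G)" "near_factorization G l S T"
  shows "card S + card T \<le> order G"
proof -
  interpret group G by fact
  have S: "S \<subseteq> carrier G" and T: "T \<subseteq> carrier G"
    and ne: "\<And>x y. x \<in> S \<Longrightarrow> y \<in> T \<Longrightarrow> x \<otimes> y \<noteq> \<one>"
    using assms(3) unfolding near_factorization_def by blast+
  let ?T' = "(\<lambda>y. inv y) ` T"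
  have "inj_on (\<lambda>y. inv y) T"
    using T by (meson inj_onI inv_inj inj_on_subset)
  then have card_inv: "card ?T' = card T"
    by (rule card_image)
  \<comment> \<open>A common element \<open>x = inv y\<close> would give
    \<open>x \<otimes> y = \<one>\<close>.\<close>
  have "S \<inter> ?T' = {}"
    using T ne by fastforce
  moreover have sub: "S \<union> ?T' \<subseteq> carrier G"
    using S T by auto
  ultimately have "card (S \<union> ?T') = card S + card ?T'"
    using assms(2) by (intro card_Un_disjoint) (auto intro: finite_subset)
  then show ?thesis
    using card_mono[OF assms(2) sub] card_inv by (simp add: order_def)
qed

text \<open>The bound \<open>3 \<le> n\<close> excludes \<open>s = t = l = 1\<close>,
  \<open>n = 2\<close>, which meets the other two conditions and occurs in the group of order 2, but
  would give \<open>4 \<le> 3\<close>.\<close>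

lemma four_mult_le_add_Suc:
  fixes n s t l :: nat
  assumes "3 \<le> n" "s + t \<le> n" "s * t = l * (n - 1)"
  shows "4 * l \<le> s + t + 1"
proof (rule ccontr)
  define u where "u = s + t"
  define m where "m = n - 1"
  assume "\<not> ?thesis"
  \<comment> \<open>Integrality enters here: failure of the bound means exceeding it by at least
    1.\<close>
  then have "u + 2 \<le> 4 * l"
    by (simp add: u_def)
  then have "(u + 2) * m \<le> 4 * l * m"
    by (rule mult_le_mono1)
  also have "\<dots> = 4 * s * t"
    using assms(3) by (simp add: m_def)
  also have "\<dots> \<le> u * u"
  proof -
    \<comment> \<open>The difference of the two sides is \<open>(s - t)\<close> squared; integers
      avoid truncated subtraction.\<close>
    have "4 * int s * int t \<le> (int s + int t) * (int s + int t)"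
      using zero_le_square[of "int s - int t"] by (simp add: algebra_simps)
    then show ?thesis
      unfolding u_def by (metis of_nat_add of_nat_le_iff of_nat_mult of_nat_numeral)
  qed
  also have "u * u \<le> u * (m + 1)"
    using assms by (intro mult_le_mono2) (simp add: u_def m_def)
  \<comment> \<open>The term \<open>u * m\<close> cancels from
    \<open>(u + 2) * m \<le> u * (m + 1)\<close>.\<close>
  finally have "2 * m \<le> u"
    by (simp add: algebra_simps)
  \<comment> \<open>With \<open>u \<le> m + 1\<close> this forces \<open>m \<le> 1\<close>, that is
    \<open>n \<le> 2\<close>.\<close>
  then show False
    using assms(1,2) by (simp add: u_def m_def)
qed

theorem theorem1p18:
  fixes G :: "('a, 'b) monoid_scheme" and n s t l :: nat
  assumes "group G" and "finite (carrier G)" and "order G = n"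
    and "3 \<le> n"
    and "\<exists>S T. st_near_factorization G s t l S T"
  shows "int l \<le> \<lfloor>(real s + real t + 1) / 4\<rfloor>"
proof -
  obtain S T where nf: "near_factorization G l S T" and "card S = s" "card T = t"
    using assms(5) unfolding st_near_factorization_def by blast
  then have "s * t = l * (n - 1)" "s + t \<le> n"
    using near_factorization_card_mult near_factorization_card_add_le assms(1-3) by metis+
  then have "4 * l \<le> s + t + 1"
    using four_mult_le_add_Suc assms(4) by blast
  then show ?thesis
    by (simp add: le_floor_iff)
qed

end
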